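(* For any rooted tree $T$, we have $\psi_T(t)=\bar\Omega(T,t)$, where on the right $T$ is viewed as the finite poset $V(T)$ with the partial order induced by ancestry (the root being the unique smallest element).
   Context: A rooted tree is a finite connected acyclic graph with a designated root $\mathrm{rt}_T$. $V(T),E(T)$ are the vertex and edge sets and $v(T)=|V(T)|$. In the ancestry order on $V(T)$, $a\le b$ iff $a$ lies on the path from $\mathrm{rt}_T$ to $b$. Strict order polynomial. For a finite poset $P$, a map $f:P\to\{1,\ldots,n\}$ is strict order-preserving if $a<b$ in $P$ implies $f(a)<f(b)$. $\bar\Omega(P,t)$ is the (well-known to exist) unique polynomial such that $\bar\Omega(P,n)$ is the number of strict order-preserving maps $P\to\{1,\ldots,n\}$ for all $n\in\mathbb{N}$. For $e\in E(T)$ let $T_e$ be the component of $T$ minus the edge $e$ containing $\mathrm{rt}_T$ (rooted at $\mathrm{rt}_T$), and $T'_e$ the other component, rooted at the endpoint of $e$ farther from $\mathrm{rt}_T$. Write $e\succ f$ if $f\in E(T_e)$; $e_1\succ\cdots\succ e_r$ means $e_i\succ e_j$ for all $i<j$. Such a sequence $\vec e$ determines rooted trees $T_{\vec e,1},\ldots,T_{\vec e,r+1}$: put $S_1=T$ and, for $i=1,\ldots,r$, $T_{\vec e,i}=(S_i)'_{e_i}$, $S_{i+1}=(S_i)_{e_i}$; finally $T_{\vec e,r+1}=S_{r+1}$. The numbers $\phi_T\in\mathbb{Q}$ are defined recursively by $\phi_T=1$ if $v(T)=1$ and, for $v(T)\ge2$, $\phi_T=-\sum_{k=2}^{v(T)}\frac{1}{k!}\sum_{\vec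 e\in E(T)^{k-1},\,e_1\succ\cdots\succ e_{k-1}}\phi_{T_{\vec e,1}}\cdots\phi_{T_{\vec e,k}}$. The polynomials $\psi_T(t)\in\mathbb{Q}[t]$ are $$\psi_T(t)=\sum_{k=1}^{v(T)}\frac{t^k}{k!}\sum_{\substack{\vec e\in E(T)^{k-1}\\ e_1\succ\cdots\succ e_{k-1}}}\phi_{T_{\vec e,1}}\cdots\phi_{T_{\vec e,k}},$$ where the inner sum for $k=1$ is $\phi_T$. *)

theory Defs
  imports "HOL-Computational_Algebra.Polynomial" "HOL-Library.FuncSet"
begin

section \<open>Rooted trees\<close>

record 'a rgraph =
  verts :: "'a set"
  edges :: "'a set set"
  rt :: 'a

definition walk :: "'a rgraph \<Rightarrow> 'a \<Rightarrow> 'a list \<Rightarrow> 'a \<Rightarrow> bool" where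
  "walk T u p v \<longleftrightarrow> p \<noteq> [] \<and> hd p = u \<and> last p = v \<and> set p \<subseteq> verts T \<and>
     successively (\<lambda>x y. {x, y} \<in> edges T) p"

definition path :: "'a rgraph \<Rightarrow> 'a \<Rightarrow> 'a list \<Rightarrow> 'a \<Rightarrow> bool" where
  "path T u p v \<longleftrightarrow> walk T u p v \<and> distinct p"

text \<open>A cycle is listed with its first vertex repeated at the end, so a list of length at least 4
  has at least three edges.\<close>

definition cycle :: "'a rgraph \<Rightarrow> 'a list \<Rightarrow> bool" where
  "cycle T p \<longleftrightarrow> (\<exists>u. walk T u p u) \<and> length p \<ge> 4 \<and> distinct (tl p)"

definition rooted_tree :: "'a rgraph \<Rightarrow> bool" where
  "rooted_tree T \<longleftrightarrow>
     finite (verts T) \<and> rt T \<in> verts T \<and>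
     (\<forall>e\<in>edges T. e \<subseteq> verts T \<and> card e = 2) \<and>
     (\<forall>u\<in>verts T. \<forall>v\<in>verts T. \<exists>p. walk T u p v) \<and>
     (\<nexists>p. cycle T p)"

lemma rooted_tree_finite_edges: "rooted_tree T \<Longrightarrow> finite (edges T)"
  unfolding rooted_tree_def by (rule finite_subset[of _ "Pow (verts T)"]) auto

definition ancestry :: "'a rgraph \<Rightarrow> 'a rel" where
  "ancestry T = {(a, b). \<exists>p. path T (rt T) p b \<and> a \<in> set p}"

definition gdist :: "'a rgraph \<Rightarrow> 'a \<Rightarrow> 'a \<Rightarrow> nat" where
  "gdist T u v = (LEAST n. \<exists>p. walk T u p v \<and> length p = Suc n)"


section \<open>Cutting edges\<close>

definition delete_edge :: "'a rgraph \<Rightarrow> 'a set \<Rightarrow> 'a rgraph" where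
  "delete_edge T e = T\<lparr>edges := edges T - {e}\<rparr>"

text \<open>The connected component of the vertex \<open>x\<close>, rooted at \<open>x\<close>.\<close>

definition component :: "'a rgraph \<Rightarrow> 'a \<Rightarrow> 'a rgraph" where
  "component T x =
     (let C = {v. \<exists>p. walk T x p v}
      in \<lparr>verts = C, edges = {f \<in> edges T. f \<subseteq> C}, rt = x\<rparr>)"

definition far_end :: "'a rgraph \<Rightarrow> 'a set \<Rightarrow> 'a" where
  "far_end T e = (THE x. x \<in> e \<and> (\<forall>y\<in>e. y \<noteq> x \<longrightarrow> gdist T (rt T) y < gdist T (rt T) x))"

text \<open>\<open>root_part T e\<close> is $T_e$ and \<open>far_part T e\<close> is $T'_e$.\<close>

definition root_part :: "'a rgraph \<Rightarrow> 'a set \<Rightarrow> 'a rgraph" where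
  "root_part T e = component (delete_edge T e) (rt T)"

definition far_part :: "'a rgraph \<Rightarrow> 'a set \<Rightarrow> 'a rgraph" where
  "far_part T e = component (delete_edge T e) (far_end T e)"

definition edge_succ :: "'a rgraph \<Rightarrow> 'a set \<Rightarrow> 'a set \<Rightarrow> bool" where
  "edge_succ T e f \<longleftrightarrow> f \<in> edges (root_part T e)"

text \<open>The relation \<open>edge_succ T\<close> need not be transitive or antisymmetric, so all pairs of positions
  are compared, always in the full tree \<open>T\<close>.\<close>

definition edge_chains :: "'a rgraph \<Rightarrow> nat \<Rightarrow> 'a set list set" where
  "edge_chains T m =
     {es. length es = m \<and> set es \<subseteq> edges T \<and> sorted_wrt (edge_succ T) es}"

text \<open>\<open>pieces T [e\<^sub>1, \<dots>, e\<^sub>r]\<close> is the list of the trees $T_{\vec e,1},\ldots,T_{\vec e,r+1}$.\<close>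

fun pieces :: "'a rgraph \<Rightarrow> 'a set list \<Rightarrow> 'a rgraph list" where
  "pieces T [] = [T]"
| "pieces T (e # es) = far_part T e # pieces (root_part T e) es"

lemma edges_component: "edges (component T x) \<subseteq> edges T"
  by (auto simp: component_def Let_def)

lemma edges_root_part: "edges (root_part T e) \<subseteq> edges T - {e}"
  using edges_component[of "delete_edge T e"] by (simp add: root_part_def delete_edge_def)

lemma edges_far_part: "edges (far_part T e) \<subseteq> edges T - {e}"
  using edges_component[of "delete_edge T e"] by (simp add: far_part_def delete_edge_def)

lemma edges_pieces: "S \<in> set (pieces T es) \<Longrightarrow> edges S \<subseteq> edges T"
proof (induction es arbitrary: T)
  case (Cons e es)
  then show ?case using edges_root_part[of T e] edges_far_part[of T e] by fastforce
qed simp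

lemma edges_pieces_psubset:
  assumes "es \<in> edge_chains T m" "m > 0" "S \<in> set (pieces T es)"
  shows "edges S \<subset> edges T"
proof -
  obtain e es' where es: "es = e # es'" and e: "e \<in> edges T"
    using assms(1,2) by (cases es) (auto simp: edge_chains_def)
  have "edges S \<subseteq> edges T - {e}"
    using assms(3) edges_root_part[of T e] edges_far_part[of T e]
      edges_pieces[of S "root_part T e" es'] unfolding es by auto
  with e show ?thesis by blast
qed


section \<open>The numbers \<open>\<phi>\<close> and the polynomials \<open>\<psi>\<close>\<close>

text \<open>The guard is needed only for termination; the value 0 off rooted trees is junk.\<close>

function phi :: "'a rgraph \<Rightarrow> rat" where
  "phi T =
     (if \<not> rooted_tree T then 0
      else if card (verts T) = 1 then 1
      else - (\<Sum>k = 2..card (verts T).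
                1 / fact k * (\<Sum>es\<in>edge_chains T (k - 1). prod_list (map phi (pieces T es)))))"
  by pat_completeness auto

termination
proof (relation "measure (\<lambda>T. card (edges T))", goal_cases)
  case (2 T k es S)
  then have "edges S \<subset> edges T"
    by (intro edges_pieces_psubset[of es T "k - 1"]) auto
  then show ?case
    using 2 rooted_tree_finite_edges[of T] by (auto intro: psubset_card_mono)
qed simp

declare phi.simps [simp del]

definition psi :: "'a rgraph \<Rightarrow> rat poly" where
  "psi T =
     (\<Sum>k = 1..card (verts T).
        monom (1 / fact k * (\<Sum>es\<in>edge_chains T (k - 1). prod_list (map phi (pieces T es)))) k)"


section \<open>The strict order polynomial\<close>

text \<open>A poset is given by its carrier \<open>A\<close> and its reflexive order relation \<open>r\<close>.\<close>

definition strict_order_maps :: "'a set \<Rightarrow> 'a rel \<Rightarrow> nat \<Rightarrow> ('a \<Rightarrow> nat) set" where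
  "strict_order_maps A r n =
     {f \<in> A \<rightarrow>\<^sub>E {1..n}. \<forall>a\<in>A. \<forall>b\<in>A. (a, b) \<in> r \<and> a \<noteq> b \<longrightarrow> f a < f b}"

definition strict_order_poly :: "'a set \<Rightarrow> 'a rel \<Rightarrow> rat poly" where
  "strict_order_poly A r =
     (THE p. \<forall>n::nat. poly p (of_nat n) = of_nat (card (strict_order_maps A r n)))"

text \<open>The polynomial above exists and is unique for every finite \<open>A\<close>: the maps with a given image
  \<open>B\<close> are counted by a number depending only on the cardinality of \<open>B\<close>.\<close>

lemma card_strict_order_maps_image:
  assumes B: "B \<subseteq> {1..n}"
  shows "card {f \<in> strict_order_maps A r n. f ` A = B} =
         card {f \<in> strict_order_maps A r (card B). f ` A = {1..card B}}"
proof -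
  have fin: "finite B" using B finite_subset by blast
  define h where "h = (\<lambda>i. if i = 0 then 0 else sorted_list_of_set B ! (i - 1))"
  have len: "length (sorted_list_of_set B) = card B" by simp
  have mono: "h i < h j" if "i \<in> {1..card B}" "j \<in> {1..card B}" "i < j" for i j
  proof -
    have "sorted_list_of_set B ! (i - 1) < sorted_list_of_set B ! (j - 1)"
      using that strict_sorted_list_of_set[of B] by (intro sorted_wrt_nth_less[of "(<)"]) auto
    then show ?thesis using that by (simp add: h_def)
  qed
  have inj: "inj_on h {1..card B}"
    by (rule linorder_inj_onI') (metis less_irrefl mono)
  have img: "h ` {1..card B} = B"
  proof (rule card_subset_eq[OF fin])
    show "h ` {1..card B} \<subseteq> B"
    proof
      fix x assume "x \<in> h ` {1..card B}"
      then obtain i where i: "i \<in> {1..card B}" "x = h i" by blast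
      then have "x \<in> set (sorted_list_of_set B)"
        unfolding h_def using len by (auto intro!: nth_mem simp del: set_sorted_list_of_set)
      then show "x \<in> B" using fin by simp
    qed
    show "card (h ` {1..card B}) = card B" using card_image[OF inj] by simp
  qed
  have mono_iff: "h i < h j \<longleftrightarrow> i < j" if "i \<in> {1..card B}" "j \<in> {1..card B}" for i j
    using mono that by (metis linorder_neq_iff order_less_asym)
  define g where "g = the_inv_into {1..card B} h"
  have hg: "h (g b) = b" "g b \<in> {1..card B}" if "b \<in> B" for b
    using that f_the_inv_into_f[OF inj, of b] the_inv_into_into[OF inj, of b "{1..card B}"] img
    unfolding g_def by auto
  have gh: "g (h i) = i" if "i \<in> {1..card B}" for i
    unfolding g_def using the_inv_into_f_f[OF inj] that by auto
  have hB: "h i \<in> B" if "i \<in> {1..card B}" for i using img that by blast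
  have "bij_betw (\<lambda>f. restrict (h \<circ> f) A)
          {f \<in> strict_order_maps A r (card B). f ` A = {1..card B}}
          {f \<in> strict_order_maps A r n. f ` A = B}"
  proof (rule bij_betw_byWitness[where f' = "\<lambda>f. restrict (g \<circ> f) A"], goal_cases)
    case 1
    show ?case
      by (auto simp: strict_order_maps_def fun_eq_iff PiE_def extensional_def gh Pi_iff)
  next
    case 2
    show ?case
      by (auto simp: strict_order_maps_def fun_eq_iff PiE_def extensional_def hg)
  next
    case 3
    show ?case
    proof
      fix f' assume "f' \<in> (\<lambda>f. restrict (h \<circ> f) A) `
        {f \<in> strict_order_maps A r (card B). f ` A = {1..card B}}"
      then obtain f where f: "f' = restrict (h \<circ> f) A" "f \<in> strict_order_maps A r (card B)"
        "f ` A = {1..card B}" by blast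
      have fA: "f a \<in> {1..card B}" if "a \<in> A" for a using f(3) that by blast
      have "f' ` A = h ` f ` A" unfolding f(1) by (auto simp: image_image)
      then have im: "f' ` A = B" using f(3) img by simp
      have "f' a < f' b" if "a \<in> A" "b \<in> A" "(a, b) \<in> r" "a \<noteq> b" for a b
        using f(2) that mono[OF fA fA] unfolding f(1) strict_order_maps_def by auto
      moreover have "f' a \<in> {1..n}" if "a \<in> A" for a using im B that by blast
      ultimately show "f' \<in> {f \<in> strict_order_maps A r n. f ` A = B}"
        using im unfolding strict_order_maps_def f(1) by auto
    qed
  next
    case 4
    show ?case
    proof
      fix f' assume "f' \<in> (\<lambda>f. restrict (g \<circ> f) A) ` {f \<in> strict_order_maps A r n. f ` A = B}"
      then obtain f where f: "f' = restrict (g \<circ> f) A" "f \<in> strict_order_maps A r n"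
        "f ` A = B" by blast
      have fA: "f a \<in> B" if "a \<in> A" for a using f(3) that by blast
      have "f' ` A = g ` f ` A" unfolding f(1) by (auto simp: image_image)
      also have "\<dots> = g ` h ` {1..card B}" using f(3) img by simp
      also have "\<dots> = {1..card B}" using gh by (auto simp: image_image)
      finally have im: "f' ` A = {1..card B}" .
      have "f' a < f' b" if ab: "a \<in> A" "b \<in> A" "(a, b) \<in> r" "a \<noteq> b" for a b
      proof -
        have "f a < f b" using f(2) ab unfolding strict_order_maps_def by auto
        then have "g (f a) < g (f b)" using mono_iff[of "g (f a)" "g (f b)"] hg fA ab by simp
        then show ?thesis using ab f(1) by simp
      qed
      moreover have "f' a \<in> {1..card B}" if "a \<in> A" for a using im that by blast
      ultimately show "f' \<in> {f \<in> strict_order_maps A r (card B). f ` A = {1..card B}}"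
        using im unfolding strict_order_maps_def f(1) by auto
    qed
  qed
  then show ?thesis using bij_betw_same_card by fastforce
qed

lemma card_strict_order_maps_sum:
  assumes A: "finite A"
  shows "card (strict_order_maps A r n) =
         (\<Sum>k\<le>card A. card {f \<in> strict_order_maps A r k. f ` A = {1..k}} * (n choose k))"
proof -
  let ?M = "strict_order_maps A r n"
  let ?c = "\<lambda>k. card {f \<in> strict_order_maps A r k. f ` A = {1..k}}"
  have finM: "finite ?M"
    by (rule finite_subset[of _ "A \<rightarrow>\<^sub>E {1..n}"])
       (auto simp: strict_order_maps_def intro!: finite_PiE A)
  have img: "f ` A \<in> {B. B \<subseteq> {1..n}}" "card (f ` A) \<le> card A" if "f \<in> ?M" for f
    using that card_image_le[OF A] by (auto simp: strict_order_maps_def)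
  let ?Bs = "{B. B \<subseteq> {1..n} \<and> card B \<le> card A}"
  have finB: "finite ?Bs" by (rule finite_subset[of _ "Pow {1..n}"]) auto
  have "card ?M = (\<Sum>B\<in>?Bs. card {f \<in> ?M. f ` A = B})"
  proof -
    have "?M = (\<Union>B\<in>?Bs. {f \<in> ?M. f ` A = B})" using img by auto
    then have "card ?M = card (\<Union>B\<in>?Bs. {f \<in> ?M. f ` A = B})" by (rule arg_cong)
    also have "\<dots> = (\<Sum>B\<in>?Bs. card {f \<in> ?M. f ` A = B})"
      by (rule card_UN_disjoint) (use finB finM in auto)
    finally show ?thesis .
  qed
  also have "\<dots> = (\<Sum>B\<in>?Bs. ?c (card B))"
    by (intro sum.cong refl card_strict_order_maps_image) auto
  also have "\<dots> = (\<Sum>k\<le>card A. \<Sum>B\<in>{B \<in> ?Bs. card B = k}. ?c (card B))"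
    by (rule sum.group[symmetric]) (use finB in auto)
  also have "\<dots> = (\<Sum>k\<le>card A. ?c k * (n choose k))"
  proof (rule sum.cong[OF refl])
    fix k assume "k \<in> {..card A}"
    then have "{B \<in> ?Bs. card B = k} = {B. B \<subseteq> {1..n} \<and> card B = k}" by auto
    moreover have "card {B. B \<subseteq> {1..n} \<and> card B = k} = n choose k"
      using n_subsets[of "{1..n}" k] by simp
    ultimately show "(\<Sum>B\<in>{B \<in> ?Bs. card B = k}. ?c (card B)) = ?c k * (n choose k)" by simp
  qed
  finally show ?thesis .
qed

lemma strict_order_poly_ex1:
  assumes "finite A"
  shows "\<exists>!p :: rat poly. \<forall>n::nat. poly p (of_nat n) = of_nat (card (strict_order_maps A r n))"
proof (rule ex_ex1I)
  define b :: "nat \<Rightarrow> rat poly" where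
    "b = (\<lambda>k. smult (1 / fact k) (\<Prod>i = 0..<k. [:- of_nat i, 1:]))"
  have b: "poly (b k) (of_nat n) = of_nat (n choose k)" for n k
    by (simp add: b_def poly_prod binomial_gbinomial gbinomial_prod_rev)
  show "\<exists>p :: rat poly. \<forall>n::nat. poly p (of_nat n) = of_nat (card (strict_order_maps A r n))"
    by (rule exI[of _ "\<Sum>k\<le>card A.
          smult (of_nat (card {f \<in> strict_order_maps A r k. f ` A = {1..k}})) (b k)"])
       (simp add: poly_sum b card_strict_order_maps_sum[OF assms])
next
  fix p q :: "rat poly"
  assume "\<forall>n::nat. poly p (of_nat n) = of_nat (card (strict_order_maps A r n))"
    and "\<forall>n::nat. poly q (of_nat n) = of_nat (card (strict_order_maps A r n))"
  then have "range of_nat \<subseteq> {x. poly (p - q) x = 0}" by auto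
  moreover have "infinite (range (of_nat :: nat \<Rightarrow> rat))"
    by (simp add: finite_image_iff inj_of_nat)
  ultimately have "infinite {x. poly (p - q) x = 0}" using finite_subset by blast
  then show "p = q" using poly_roots_finite[of "p - q"] by auto
qed

lemma poly_strict_order_poly:
  assumes "finite A"
  shows "poly (strict_order_poly A r) (of_nat n) = of_nat (card (strict_order_maps A r n))"
  using theI'[OF strict_order_poly_ex1[OF assms, of r]] unfolding strict_order_poly_def by blast

end

theory Submission
  imports Defs "HOL-Library.Sublist"
begin

text \<open>
  Write \<open>P\<^sub>T\<close> for the strict order polynomial of a rooted tree \<open>T\<close>, and \<open>\<lambda>\<^sub>T\<close> for its linear
  coefficient. Both \<open>\<psi>\<^sub>T\<close> and \<open>P\<^sub>T\<close> satisfy a differential equation of the same shape, in which the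
  right-hand side refers to smaller trees only:
  \[ \psi_T' = \phi_T + \sum_{e} \phi_{T'_e}\, \psi_{T_e}, \qquad
     P_T' = \lambda_T + \sum_{e} \lambda_{T'_e}\, P_{T_e}. \]

  For \<open>\<psi>\<close> (lemma \<open>pderiv_psi\<close>) this is the choice of the first edge \<open>e\<close> of a chain: it
  splits off the piece $T'_e$, and the rest of the chain is an arbitrary chain of $T_e$.

  For the strict order polynomial (lemma \<open>pderiv_order_poly\<close>) the reason is the addition formula
  \[ P_A(s + t) = \sum_U P_{A \setminus U}(s)\, P_U(t), \]
  where \<open>U\<close> runs over the up-sets of the finite poset \<open>A\<close>. Comparing coefficients of \<open>t\<close>
  gives the derivative. If \<open>U\<close> is empty, \<open>P\<^sub>U = 1\<close> has no linear term; if \<open>U\<close> splits into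
  two unrelated nonempty parts, \<open>P\<^sub>U\<close> is a product of two polynomials without constant term. In a
  tree the remaining up-sets have a least element, so they are \<open>T\<close> itself and the far parts $T'_e$.

  The proof is by induction on the number of edges. As \<open>\<phi>\<close> of a tree is the linear coefficient of
  its \<open>\<psi>\<close>, the induction hypothesis makes the two sums over \<open>e\<close> equal, and \<open>\<psi>\<^sub>T - P\<^sub>T\<close> has constant
  derivative. Both polynomials vanish at 0. At 1 both are 1 if \<open>T\<close> is a single vertex and 0
  otherwise: for \<open>\<psi>\<close> this is the recursion that defines \<open>\<phi>\<close>, and for \<open>P\<close> it says that a
  constant map is not strictly order-preserving on two or more vertices. Hence \<open>\<psi>\<^sub>T = P\<^sub>T\<close>.

  The translation from graphs to posets rests on the uniqueness of paths: the list of vertices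
  from the root to \<open>v\<close> determines \<open>v\<close>, ancestry is the prefix order on these lists, and an edge
  joins two vertices one of whose lists extends the other by one entry.\<close>

section \<open>Strict order polynomials of finite posets\<close>

lemma strict_order_maps_finite:
  assumes "finite A"
  shows "finite (strict_order_maps A r n)"
  by (rule finite_subset[of _ "A \<rightarrow>\<^sub>E {1..n}"])
     (auto simp: strict_order_maps_def intro!: finite_PiE assms)

lemma strict_order_maps_cong:
  assumes "\<And>a b. a \<in> A \<Longrightarrow> b \<in> A \<Longrightarrow> (a, b) \<in> r \<longleftrightarrow> (a, b) \<in> r'"
  shows "strict_order_maps A r n = strict_order_maps A r' n"
  unfolding strict_order_maps_def using assms by blast

lemma strict_order_poly_cong:
  assumes "\<And>a b. a \<in> A \<Longrightarrow> b \<in> A \<Longrightarrow> (a, b) \<in> r \<longleftrightarrow> (a, b) \<in> r'"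
  shows "strict_order_poly A r = strict_order_poly A r'"
  unfolding strict_order_poly_def using strict_order_maps_cong[of A r r'] assms by simp

text \<open>A nonzero polynomial has finitely many zeros, so polynomial identities may be checked at the
  natural numbers, where strict order polynomials count maps.\<close>

lemma poly_eqI_nat:
  fixes p q :: "'a::{idom,ring_char_0} poly"
  assumes "\<And>n. poly p (of_nat n) = poly q (of_nat n)"
  shows "p = q"
proof -
  have "range of_nat \<subseteq> {x. poly (p - q) x = 0}" using assms by auto
  moreover have "infinite (range (of_nat :: nat \<Rightarrow> 'a))"
    by (simp add: finite_image_iff inj_of_nat)
  ultimately have "infinite {x. poly (p - q) x = 0}" using finite_subset by blast
  then show ?thesis using poly_roots_finite[of "p - q"] by auto
qed

lemma strict_order_poly_empty: "strict_order_poly {} r = 1"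
  by (rule poly_eqI_nat)
     (simp add: poly_strict_order_poly strict_order_maps_def)

lemma poly_strict_order_poly_0:
  assumes "finite A" "A \<noteq> {}"
  shows "poly (strict_order_poly A r) 0 = 0"
proof -
  have "strict_order_maps A r 0 = {}"
    using assms(2) by (auto simp: strict_order_maps_def PiE_eq_empty_iff)
  then show ?thesis using poly_strict_order_poly[OF assms(1), of r 0] by simp
qed

text \<open>Functions on a disjoint union are pairs of functions. Both ways of splitting a strict order map
  used below, by its values and by the components of the poset, come down to this.\<close>

lemma card_glue:
  fixes B C :: "'a set" and S R :: "('a \<Rightarrow> 'b) set"
  assumes disj: "B \<inter> C = {}" and S: "S \<subseteq> extensional B" and R: "R \<subseteq> extensional C"
  shows "card {f \<in> extensional (B \<union> C). restrict f B \<in> S \<and> restrict f C \<in> R} = card S * card R"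
proof -
  let ?F = "{f \<in> extensional (B \<union> C). restrict f B \<in> S \<and> restrict f C \<in> R}"
  let ?glue = "\<lambda>(g, h). \<lambda>x. if x \<in> B then g x else h x"
  have res: "restrict (?glue (g, h)) B = g" "restrict (?glue (g, h)) C = h"
    if "g \<in> S" "h \<in> R" for g h
    using that disj S R by (auto simp: fun_eq_iff extensional_def restrict_def)
  have ext: "?glue (g, h) \<in> extensional (B \<union> C)" if "h \<in> R" for g h
    using that R by (auto simp: extensional_def)
  have unglue: "?glue (restrict f B, restrict f C) = f" if "f \<in> extensional (B \<union> C)" for f
    using that by (auto simp: fun_eq_iff extensional_def restrict_def)
  have "bij_betw (\<lambda>f. (restrict f B, restrict f C)) ?F (S \<times> R)"
    by (rule bij_betw_byWitness[where f' = ?glue]) (use res ext unglue in auto)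
  then show ?thesis using bij_betw_same_card[of _ ?F "S \<times> R"] by (simp add: card_cartesian_product)
qed

lemma card_strict_order_maps_shift:
  "card {f \<in> U \<rightarrow>\<^sub>E {s + 1..s + t}. \<forall>a\<in>U. \<forall>b\<in>U. (a, b) \<in> r \<and> a \<noteq> b \<longrightarrow> f a < f b} =
   card (strict_order_maps U r t)"
  (is "card ?R = _")
proof -
  have "bij_betw (\<lambda>f. \<lambda>x\<in>U. f x + s) (strict_order_maps U r t) ?R"
  proof (rule bij_betw_byWitness[where f' = "\<lambda>f. \<lambda>x\<in>U. f x - s"])
    show "(\<lambda>f. \<lambda>x\<in>U. f x + s) ` strict_order_maps U r t \<subseteq> ?R"
      by (auto simp: strict_order_maps_def PiE_iff)
    show "(\<lambda>f. \<lambda>x\<in>U. f x - s) ` ?R \<subseteq> strict_order_maps U r t"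
    proof (rule image_subsetI)
      fix f assume f: "f \<in> ?R"
      have val: "s < f a" "f a \<le> s + t" if "a \<in> U" for a
        using f that by (auto simp: PiE_iff Suc_le_eq)
      have "f a - s \<in> {1..t}" if "a \<in> U" for a
        using val[OF that] by auto
      moreover have "f a - s < f b - s" if "a \<in> U" "b \<in> U" "(a, b) \<in> r" "a \<noteq> b" for a b
        using val[OF that(1)] f that by (auto intro!: diff_less_mono)
      ultimately show "(\<lambda>x\<in>U. f x - s) \<in> strict_order_maps U r t"
        by (simp add: strict_order_maps_def PiE_iff)
    qed
    show "\<forall>f\<in>strict_order_maps U r t. (\<lambda>x\<in>U. (\<lambda>x\<in>U. f x + s) x - s) = f"
      by (auto simp: strict_order_maps_def PiE_iff extensional_def)
    have "(\<lambda>x\<in>U. (\<lambda>x\<in>U. f x - s) x + s) = f" if "f \<in> ?R" for f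
    proof
      fix x
      show "(\<lambda>x\<in>U. (\<lambda>x\<in>U. f x - s) x + s) x = f x"
        using that by (cases "x \<in> U") (auto simp: PiE_iff extensional_def dest!: bspec[of _ _ x])
    qed
    then show "\<forall>f\<in>?R. (\<lambda>x\<in>U. (\<lambda>x\<in>U. f x - s) x + s) = f" by blast
  qed
  then show ?thesis by (rule bij_betw_same_card[symmetric])
qed

definition up_sets :: "'a set \<Rightarrow> 'a rel \<Rightarrow> 'a set set" where
  "up_sets A r = {U. U \<subseteq> A \<and> (\<forall>a\<in>U. \<forall>b\<in>A. (a, b) \<in> r \<longrightarrow> b \<in> U)}"

lemma finite_up_sets: "finite A \<Longrightarrow> finite (up_sets A r)"
  by (rule finite_subset[of _ "Pow A"]) (auto simp: up_sets_def)

text \<open>A strict order map \<open>f\<close> into \<open>{1..s + t}\<close> is cut at height \<open>s\<close>. The elements with value above \<open>s\<close>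
  form an up-set \<open>U\<close>, and \<open>f\<close> is glued from a map of the complement into \<open>{1..s}\<close> and a map of \<open>U\<close>
  into \<open>{s + 1..s + t}\<close>. Conversely every such pair may be glued, because no element of \<open>U\<close> lies
  below one outside \<open>U\<close>.\<close>

lemma card_strict_order_maps_add:
  assumes A: "finite A"
  shows "card (strict_order_maps A r (s + t)) =
    (\<Sum>U\<in>up_sets A r. card (strict_order_maps (A - U) r s) * card (strict_order_maps U r t))"
proof -
  let ?M = "strict_order_maps A r (s + t)"
  let ?H = "\<lambda>f. {a \<in> A. s < f a}"
  have H: "?H f \<in> up_sets A r" if "f \<in> ?M" for f
    using that unfolding up_sets_def strict_order_maps_def by fastforce
  have "card ?M = (\<Sum>U\<in>up_sets A r. \<Sum>f\<in>{f \<in> ?M. ?H f = U}. 1)"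
    using sum.group[OF strict_order_maps_finite[OF A] finite_up_sets[OF A],
        of ?H r "s + t" r "\<lambda>_. 1 :: nat"] H by (simp add: image_subset_iff)
  also have "\<dots> = (\<Sum>U\<in>up_sets A r. card (strict_order_maps (A - U) r s) * card (strict_order_maps U r t))"
  proof (rule sum.cong[OF refl])
    fix U assume U: "U \<in> up_sets A r"
    then have UA: "U \<subseteq> A" by (simp add: up_sets_def)
    let ?R = "{f \<in> U \<rightarrow>\<^sub>E {s + 1..s + t}. \<forall>a\<in>U. \<forall>b\<in>U. (a, b) \<in> r \<and> a \<noteq> b \<longrightarrow> f a < f b}"
    have AU: "(A - U) \<union> U = A" using UA by blast
    have "{f \<in> ?M. ?H f = U} =
      {f \<in> extensional ((A - U) \<union> U).
         restrict f (A - U) \<in> strict_order_maps (A - U) r s \<and> restrict f U \<in> ?R}"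
    proof (intro set_eqI iffI)
      fix f assume "f \<in> {f \<in> ?M. ?H f = U}"
      then have f: "f \<in> ?M" and HU: "?H f = U" by auto
      have "f a \<in> {1..s}" if "a \<in> A - U" for a
        using that f HU by (auto simp: strict_order_maps_def PiE_iff)
      moreover have "f a \<in> {s + 1..s + t}" if "a \<in> U" for a
        using that f HU by (auto simp: strict_order_maps_def PiE_iff)
      ultimately show "f \<in> {f \<in> extensional ((A - U) \<union> U).
         restrict f (A - U) \<in> strict_order_maps (A - U) r s \<and> restrict f U \<in> ?R}"
        using f UA unfolding strict_order_maps_def AU by (auto simp: PiE_iff subset_iff)
    next
      fix f assume f: "f \<in> {f \<in> extensional ((A - U) \<union> U).
         restrict f (A - U) \<in> strict_order_maps (A - U) r s \<and> restrict f U \<in> ?R}"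
      have lo: "f a \<in> {1..s}" if "a \<in> A - U" for a
        using that f by (auto simp: strict_order_maps_def PiE_iff)
      have hi: "f a \<in> {s + 1..s + t}" if "a \<in> U" for a
        using that f by (auto simp: PiE_iff)
      have "f a < f b" if ab: "a \<in> A" "b \<in> A" "(a, b) \<in> r" "a \<noteq> b" for a b
      proof (cases "a \<in> U")
        case True
        then have "b \<in> U" using U ab unfolding up_sets_def by blast
        then show ?thesis using True f ab by auto
      next
        case False
        show ?thesis
        proof (cases "b \<in> U")
          case True
          then show ?thesis using lo[of a] hi[of b] False ab by auto
        next
          case b: False
          then show ?thesis using False f ab by (auto simp: strict_order_maps_def)
        qed
      qed
      moreover have "f a \<in> {1..s + t}" if "a \<in> A" for a
        using lo[of a] hi[of a] that by (cases "a \<in> U") auto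
      ultimately have "f \<in> ?M" using f AU by (auto simp: strict_order_maps_def PiE_iff)
      moreover have "?H f = U"
      proof (intro set_eqI iffI)
        fix a assume "a \<in> ?H f"
        then show "a \<in> U" using lo[of a] by (cases "a \<in> U") auto
      next
        fix a assume "a \<in> U"
        then show "a \<in> ?H f" using hi[of a] UA by auto
      qed
      ultimately show "f \<in> {f \<in> ?M. ?H f = U}" by simp
    qed
    then have "card {f \<in> ?M. ?H f = U} = card (strict_order_maps (A - U) r s) * card ?R"
      using card_glue[of "A - U" U "strict_order_maps (A - U) r s" ?R]
      by (auto simp: strict_order_maps_def PiE_iff)
    then show "(\<Sum>f\<in>{f \<in> ?M. ?H f = U}. 1) =
      card (strict_order_maps (A - U) r s) * card (strict_order_maps U r t)"
      unfolding card_strict_order_maps_shift by simp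
  qed
  finally show ?thesis .
qed

lemma strict_order_poly_disjoint_sum:
  assumes "finite B" "finite C" and disj: "B \<inter> C = {}"
    and unrel: "\<And>b c. b \<in> B \<Longrightarrow> c \<in> C \<Longrightarrow> (b, c) \<notin> r \<and> (c, b) \<notin> r"
  shows "strict_order_poly (B \<union> C) r = strict_order_poly B r * strict_order_poly C r"
proof (rule poly_eqI_nat)
  fix n
  have "strict_order_maps (B \<union> C) r n = {f \<in> extensional (B \<union> C).
      restrict f B \<in> strict_order_maps B r n \<and> restrict f C \<in> strict_order_maps C r n}"
    using unrel by (auto simp: strict_order_maps_def PiE_iff)
  then have "card (strict_order_maps (B \<union> C) r n) =
      card (strict_order_maps B r n) * card (strict_order_maps C r n)"
    using card_glue[OF disj, of "strict_order_maps B r n" "strict_order_maps C r n"]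
    by (auto simp: strict_order_maps_def PiE_iff)
  then show "poly (strict_order_poly (B \<union> C) r) (of_nat n) =
      poly (strict_order_poly B r * strict_order_poly C r) (of_nat n)"
    using assms(1,2) by (simp add: poly_strict_order_poly)
qed

lemma coeff_1_eq_poly_pderiv: "coeff p 1 = poly (pderiv p) 0"
  by (simp add: poly_0_coeff_0 coeff_pderiv)

text \<open>This is the coefficient of \<open>t\<close> in the preceding addition formula: for fixed \<open>s\<close> both sides
  of it are polynomials in \<open>t\<close>, and the coefficient of \<open>t\<close> in \<open>p (s + t)\<close> is the derivative of \<open>p\<close>
  at \<open>s\<close>.\<close>

lemma pderiv_strict_order_poly:
  assumes A: "finite A"
  shows "pderiv (strict_order_poly A r) =
    (\<Sum>U\<in>up_sets A r. smult (coeff (strict_order_poly U r) 1) (strict_order_poly (A - U) r))"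
proof (rule poly_eqI_nat)
  fix s
  let ?P = "\<lambda>B. strict_order_poly B r"
  let ?x = "of_nat s :: rat"
  have fin: "finite U" if "U \<in> up_sets A r" for U
    using that A finite_subset unfolding up_sets_def by blast
  have "pcompose (?P A) [:?x, 1:] = (\<Sum>U\<in>up_sets A r. smult (poly (?P (A - U)) ?x) (?P U))"
  proof (rule poly_eqI_nat)
    fix t
    show "poly (pcompose (?P A) [:?x, 1:]) (of_nat t) =
      poly (\<Sum>U\<in>up_sets A r. smult (poly (?P (A - U)) ?x) (?P U)) (of_nat t)"
      using poly_strict_order_poly[OF A, of r "s + t"] A fin
      by (simp add: poly_pcompose poly_sum poly_strict_order_poly card_strict_order_maps_add)
  qed
  then have "coeff (pcompose (?P A) [:?x, 1:]) 1 =
      (\<Sum>U\<in>up_sets A r. poly (?P (A - U)) ?x * coeff (?P U) 1)"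
    by (simp add: coeff_sum)
  moreover have "coeff (pcompose (?P A) [:?x, 1:]) 1 = poly (pderiv (?P A)) ?x"
    unfolding coeff_1_eq_poly_pderiv by (simp add: pderiv_pcompose poly_pcompose pderiv_pCons)
  ultimately show "poly (pderiv (?P A)) ?x =
      poly (\<Sum>U\<in>up_sets A r. smult (coeff (?P U) 1) (?P (A - U))) ?x"
    by (simp add: poly_sum mult.commute)
qed

lemma finite_has_minimal_element:
  assumes "finite U" "U \<noteq> {}" "trans r" "antisym r"
  obtains u where "u \<in> U" "\<And>x. x \<in> U \<Longrightarrow> (x, u) \<in> r \<Longrightarrow> x = u"
proof -
  let ?d = "\<lambda>u. {x \<in> U. (x, u) \<in> r \<and> x \<noteq> u}"
  obtain u where u: "u \<in> U" and least: "\<And>x. x \<in> U \<Longrightarrow> card (?d u) \<le> card (?d x)"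
    using assms(2) ex_has_least_nat[of "\<lambda>u. u \<in> U" _ "\<lambda>u. card (?d u)"] by blast
  show ?thesis
  proof (rule that[OF u], rule ccontr)
    fix x assume x: "x \<in> U" "(x, u) \<in> r" "x \<noteq> u"
    have "y \<in> ?d u" if "y \<in> ?d x" for y
      using that x assms(3,4) unfolding trans_def antisym_def by blast
    then have "?d x \<subset> ?d u" using x by blast
    then have "card (?d x) < card (?d u)" using assms(1) by (intro psubset_card_mono) auto
    then show False using least[OF x(1)] by simp
  qed
qed

text \<open>Take a minimal element \<open>u\<close> of \<open>U\<close>. In a forest the elements above \<open>u\<close> are unrelated to the rest
  of \<open>U\<close>, so if that rest is not empty, the polynomial of \<open>U\<close> is a product of two polynomials that
  vanish at 0 and thus has no linear term.\<close>

lemma coeff_1_strict_order_poly_up_set: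
  assumes A: "finite A" and refl: "refl_on A r" and "trans r" and "antisym r"
    and forest: "\<And>a b c. (a, c) \<in> r \<Longrightarrow> (b, c) \<in> r \<Longrightarrow> (a, b) \<in> r \<or> (b, a) \<in> r"
    and U: "U \<in> up_sets A r" and not_principal: "\<And>u. u \<in> A \<Longrightarrow> U \<noteq> {x \<in> A. (u, x) \<in> r}"
  shows "coeff (strict_order_poly U r) 1 = 0"
proof (cases "U = {}")
  case True
  then show ?thesis by (simp add: strict_order_poly_empty)
next
  case False
  have UA: "U \<subseteq> A" using U by (simp add: up_sets_def)
  have fin: "finite U" using UA A finite_subset by blast
  obtain u where u: "u \<in> U" and min: "\<And>x. x \<in> U \<Longrightarrow> (x, u) \<in> r \<Longrightarrow> x = u"
    using finite_has_minimal_element[OF fin False assms(3,4)] by blast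
  define B where "B = {x \<in> A. (u, x) \<in> r}"
  have BU: "B \<subseteq> U" using U u unfolding up_sets_def B_def by blast
  have "u \<in> B" using u UA refl unfolding B_def refl_on_def by blast
  have "U - B \<noteq> {}" using BU not_principal[of u] u UA unfolding B_def by blast
  have unrel: "(b, c) \<notin> r \<and> (c, b) \<notin> r" if "b \<in> B" "c \<in> U - B" for b c
  proof (intro conjI notI)
    assume "(b, c) \<in> r"
    then have "(u, c) \<in> r" using that(1) assms(3) unfolding B_def trans_def by blast
    then show False using that(2) UA unfolding B_def by blast
  next
    assume "(c, b) \<in> r"
    then have "(c, u) \<in> r \<or> (u, c) \<in> r" using forest[of c b u] that(1) unfolding B_def by blast
    then show False using that(2) min[of c] \<open>u \<in> B\<close> UA unfolding B_def by blast
  qed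
  have finB: "finite B" "finite (U - B)" using BU fin finite_subset by auto
  have "strict_order_poly U r = strict_order_poly B r * strict_order_poly (U - B) r"
    using strict_order_poly_disjoint_sum[of B "U - B" r] finB unrel BU
    by (simp add: Un_absorb1)
  moreover have "poly (strict_order_poly B r) 0 = 0"
    using poly_strict_order_poly_0[OF finB(1)] \<open>u \<in> B\<close> by blast
  moreover have "poly (strict_order_poly (U - B) r) 0 = 0"
    using poly_strict_order_poly_0[OF finB(2) \<open>U - B \<noteq> {}\<close>] .
  ultimately show ?thesis
    unfolding coeff_1_eq_poly_pderiv by (simp add: pderiv_mult)
qed

lemma pderiv_strict_order_poly_forest:
  assumes A: "finite A" and refl: "refl_on A r" and "trans r" and "antisym r"
    and forest: "\<And>a b c. (a, c) \<in> r \<Longrightarrow> (b, c) \<in> r \<Longrightarrow> (a, b) \<in> r \<or> (b, a) \<in> r"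
  shows "pderiv (strict_order_poly A r) =
    (\<Sum>u\<in>A. smult (coeff (strict_order_poly {x \<in> A. (u, x) \<in> r} r) 1)
                  (strict_order_poly {x \<in> A. (u, x) \<notin> r} r))"
proof -
  let ?up = "\<lambda>u. {x \<in> A. (u, x) \<in> r}"
  let ?g = "\<lambda>U. smult (coeff (strict_order_poly U r) 1) (strict_order_poly (A - U) r)"
  have inj: "inj_on ?up A"
  proof (rule inj_onI)
    fix a b assume ab: "a \<in> A" "b \<in> A" "?up a = ?up b"
    then have "a \<in> ?up b" "b \<in> ?up a" using refl unfolding refl_on_def by blast+
    then show "a = b" using assms(4) unfolding antisym_def by blast
  qed
  have "?up ` A \<subseteq> up_sets A r"
    using assms(3) unfolding up_sets_def trans_def by blast
  then have "pderiv (strict_order_poly A r) = sum ?g (?up ` A)"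
    unfolding pderiv_strict_order_poly[OF A]
    using coeff_1_strict_order_poly_up_set[OF A refl assms(3,4) forest]
    by (intro sum.mono_neutral_right) (auto simp: finite_up_sets[OF A] image_iff)
  also have "\<dots> = (\<Sum>u\<in>A. ?g (?up u))" using sum.reindex[OF inj] by simp
  finally have *: "pderiv (strict_order_poly A r) = (\<Sum>u\<in>A. ?g (?up u))" .
  have "A - ?up u = {x \<in> A. (u, x) \<notin> r}" for u by blast
  then show ?thesis unfolding * by (simp only:)
qed


section \<open>Paths in rooted trees and the ancestry order\<close>

lemma walk_append_iff:
  "walk T u (xs @ y # ys) v \<longleftrightarrow> walk T u (xs @ [y]) y \<and> walk T y (y # ys) v"
  by (auto simp: walk_def hd_append successively_append_iff)

lemma walk_Cons_iff:
  "walk T u (x # y # ys) v \<longleftrightarrow> u = x \<and> x \<in> verts T \<and> {x, y} \<in> edges T \<and> walk T y (y # ys) v"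
  by (auto simp: walk_def)

lemma walk_single_iff [simp]: "walk T u [x] v \<longleftrightarrow> u = x \<and> v = x \<and> x \<in> verts T"
  by (auto simp: walk_def)

lemma walk_rev: "walk T u p v \<Longrightarrow> walk T v (rev p) u"
  by (simp add: walk_def hd_rev last_rev insert_commute)

lemma walk_snoc:
  assumes "walk T u p x" "{x, y} \<in> edges T" "y \<in> verts T"
  shows "walk T u (p @ [y]) y"
  using assms by (auto simp: walk_def successively_append_iff)

lemma walk_mono:
  assumes "walk S u p v" "verts S \<subseteq> verts T" "edges S \<subseteq> edges T"
  shows "walk T u p v"
proof -
  have "successively (\<lambda>x y. {x, y} \<in> edges T) p"
    by (rule successively_mono[of "\<lambda>x y. {x, y} \<in> edges S"]) (use assms in \<open>auto simp: walk_def\<close>)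
  then show ?thesis using assms by (auto simp: walk_def)
qed

lemma walk_end_in_verts: "walk T u p v \<Longrightarrow> v \<in> verts T"
  using last_in_set[of p] by (auto simp: walk_def)

lemma walk_in_closed_set:
  assumes "walk T u p v" "u \<in> C"
    and "\<And>a b. a \<in> C \<Longrightarrow> {a, b} \<in> edges T \<Longrightarrow> b \<in> C"
  shows "v \<in> C"
  using assms(1,2)
proof (induction p arbitrary: u)
  case (Cons x p)
  then show ?case using assms(3) by (cases p) (auto simp: walk_Cons_iff)
qed (simp add: walk_def)

lemma walk_shorten:
  assumes "walk T u p v"
  obtains q where "path T u q v" "length q \<le> length p"
  using assms
proof (induction p arbitrary: thesis rule: length_induct)
  case (1 p)
  show ?case
  proof (cases "distinct p")
    case True
    then show ?thesis using 1(2,3) by (auto simp: path_def)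
  next
    case False
    then obtain xs y ys zs where p: "p = xs @ [y] @ ys @ [y] @ zs"
      using not_distinct_decomp by blast
    have "walk T u (xs @ [y]) y" "walk T y (y # zs) v"
      using 1(3) walk_append_iff[of T u xs y "ys @ y # zs" v]
        walk_append_iff[of T y "y # ys" y zs v] by (auto simp: p)
    then have "walk T u (xs @ y # zs) v" using walk_append_iff by fast
    moreover have "length (xs @ y # zs) < length p" by (simp add: p)
    ultimately obtain q where "path T u q v" "length q \<le> length (xs @ y # zs)"
      using 1(1) by blast
    then show ?thesis using 1(2) \<open>length (xs @ y # zs) < length p\<close> by simp
  qed
qed

lemma path_appendD:
  assumes "path T u (xs @ y # ys) v"
  shows "path T u (xs @ [y]) y" "path T y (y # ys) v"
  using assms walk_append_iff[of T u xs y ys v] by (auto simp: path_def)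

text \<open>After the common prefix of two paths with the same ends is stripped, they leave a vertex \<open>u\<close> along
  different edges. Let \<open>w\<close> be the first vertex of one path that lies on the other; following
  the first path from \<open>u\<close> to \<open>w\<close> and the second one back to \<open>u\<close> is a cycle.\<close>

lemma acyclic_path_unique:
  assumes acyclic: "\<nexists>c. cycle T c"
    and "path T u p v" "path T u q v"
  shows "p = q"
  using assms(2,3)
proof (induction p arbitrary: u q)
  case Nil
  then show ?case by (simp add: path_def walk_def)
next
  case (Cons x p u q')
  obtain q where q': "q' = u # q" and x: "x = u"
    using Cons.prems by (cases q') (auto simp: path_def walk_def)
  have wp: "path T u (u # p) v" and wq: "path T u (u # q) v"
    using Cons.prems by (simp_all add: x q')
  consider "p = []" | "q = []" | a p'' b q'' where "p = a # p''" "q = b # q''"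
    by (metis neq_Nil_conv)
  then show ?case
  proof cases
    case 1
    then have "v = u" using wp by (simp add: path_def walk_def)
    then have "q = []" using wq last_in_set[of q] by (auto simp: path_def walk_def split: if_splits)
    then show ?thesis by (simp add: 1 x q')
  next
    case 2
    then have "v = u" using wq by (simp add: path_def walk_def)
    then have "p = []" using wp last_in_set[of p] by (auto simp: path_def walk_def split: if_splits)
    then show ?thesis by (simp add: 2 x q')
  next
    case 3
    have pa: "path T a p v" and qb: "path T b q v"
      using wp wq path_appendD(2)[of T u "[u]"] by (auto simp: 3)
    show ?thesis
    proof (cases "a = b")
      case True
      then show ?thesis using Cons.IH[OF pa] qb by (simp add: x q')
    next
      case False
      have "v \<in> set p" "v \<in> set q"
        using pa qb last_in_set[of p] last_in_set[of q] by (auto simp: 3 path_def walk_def)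
      then have "\<exists>w\<in>set p. w \<in> set q" by blast
      then obtain p1 w p2 where p: "p = p1 @ w # p2" and w: "w \<in> set q"
        and first: "\<forall>y\<in>set p1. y \<notin> set q"
        using split_list_first_prop[of p "\<lambda>w. w \<in> set q"] by blast
      obtain q1 q2 where q: "q = q1 @ w # q2" using split_list[OF w] by blast
      \<comment> \<open>\<open>p1\<close> and \<open>q1\<close> cannot both be empty, since then \<open>a = w = b\<close>; this gives the length bound
        for a cycle.\<close>
      let ?c = "(u # p1) @ w # (rev q1 @ [u])"
      have "walk T u ((u # p1) @ [w]) w"
        using path_appendD(1)[of T u "u # p1" w p2 v] wp by (simp add: p path_def)
      moreover have "walk T w (rev ((u # q1) @ [w])) u"
        using path_appendD(1)[of T u "u # q1" w q2 v] wq
        by (intro walk_rev) (simp add: q path_def)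
      ultimately have "walk T u ?c u"
        using walk_append_iff[of T u "u # p1" w "rev q1 @ [u]" u] by simp
      moreover have "distinct (tl ?c)"
        using wp wq first by (auto simp: path_def p q)
      moreover have "p1 \<noteq> [] \<or> q1 \<noteq> []"
        using False p q 3 by auto
      then have "length ?c \<ge> 4" by (cases p1; cases q1) auto
      ultimately show ?thesis using acyclic unfolding cycle_def by blast
    qed
  qed
qed

definition root_path :: "'a rgraph \<Rightarrow> 'a \<Rightarrow> 'a list" where
  "root_path T v = (THE p. path T (rt T) p v)"

context
  fixes T :: "'a rgraph"
  assumes T: "rooted_tree T"
begin

lemma edge_verts: "{x, y} \<in> edges T \<Longrightarrow> x \<in> verts T \<and> y \<in> verts T \<and> x \<noteq> y"
  using T by (fastforce simp: rooted_tree_def)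

lemma root_path_eqI:
  assumes "path T (rt T) p v"
  shows "root_path T v = p"
  unfolding root_path_def
  using assms acyclic_path_unique[of T] T by (intro the_equality) (auto simp: rooted_tree_def)

lemma path_root_path:
  assumes "v \<in> verts T"
  shows "path T (rt T) (root_path T v) v"
proof -
  obtain p where p: "walk T (rt T) p v" using T assms unfolding rooted_tree_def by blast
  obtain q where q: "path T (rt T) q v" using walk_shorten[OF p] .
  show ?thesis using q root_path_eqI[OF q] by simp
qed

lemma root_path_props:
  assumes "v \<in> verts T"
  shows "root_path T v \<noteq> []" "hd (root_path T v) = rt T" "last (root_path T v) = v"
    "distinct (root_path T v)" "set (root_path T v) \<subseteq> verts T" "v \<in> set (root_path T v)"
    "rt T \<in> set (root_path T v)"
  using path_root_path[OF assms] last_in_set[of "root_path T v"] hd_in_set[of "root_path T v"]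
  by (auto simp: path_def walk_def)

lemma root_path_append:
  assumes "b \<in> verts T" "root_path T b = xs @ a # ys"
  shows "root_path T a = xs @ [a]"
  using path_appendD(1)[of T "rt T" xs a ys b] path_root_path[OF assms(1)] assms(2)
  by (auto intro: root_path_eqI)

lemma ancestry_iff: "(a, b) \<in> ancestry T \<longleftrightarrow> b \<in> verts T \<and> a \<in> set (root_path T b)"
proof
  assume "(a, b) \<in> ancestry T"
  then obtain p where p: "path T (rt T) p b" "a \<in> set p" unfolding ancestry_def by blast
  have "b \<in> verts T" using p(1) last_in_set[of p] by (auto simp: path_def walk_def)
  then show "b \<in> verts T \<and> a \<in> set (root_path T b)" using p root_path_eqI[OF p(1)] by simp
next
  assume "b \<in> verts T \<and> a \<in> set (root_path T b)"
  then show "(a, b) \<in> ancestry T" using path_root_path unfolding ancestry_def by blast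
qed

lemma ancestry_verts: "(a, b) \<in> ancestry T \<Longrightarrow> a \<in> verts T \<and> b \<in> verts T"
  using ancestry_iff root_path_props(5) by blast

text \<open>Replacing vertices by their root paths turns ancestry into the prefix order on lists, and the order
  axioms and the forest property are inherited from that order.\<close>

lemma ancestry_iff_prefix:
  assumes "a \<in> verts T" "b \<in> verts T"
  shows "(a, b) \<in> ancestry T \<longleftrightarrow> prefix (root_path T a) (root_path T b)"
proof
  assume "(a, b) \<in> ancestry T"
  then obtain xs ys where xy: "root_path T b = xs @ a # ys"
    using ancestry_iff split_list by metis
  then show "prefix (root_path T a) (root_path T b)"
    using root_path_append[OF assms(2) xy] by (simp add: prefix_def)
next
  assume "prefix (root_path T a) (root_path T b)"
  then show "(a, b) \<in> ancestry T"
    using ancestry_iff root_path_props(6)[OF assms(1)] assms(2) set_mono_prefix by blast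
qed

lemma root_path_inj: "a \<in> verts T \<Longrightarrow> b \<in> verts T \<Longrightarrow> root_path T a = root_path T b \<Longrightarrow> a = b"
  using root_path_props(3) by metis

lemma refl_on_ancestry: "refl_on (verts T) (ancestry T)"
  using ancestry_iff root_path_props(6) by (auto simp: refl_on_def)

lemma trans_ancestry: "trans (ancestry T)"
  by (rule transI) (meson ancestry_iff_prefix ancestry_verts prefix_order.trans)

lemma antisym_ancestry: "antisym (ancestry T)"
  by (rule antisymI) (meson ancestry_iff_prefix ancestry_verts prefix_order.antisym root_path_inj)

lemma ancestry_forest:
  "(a, c) \<in> ancestry T \<Longrightarrow> (b, c) \<in> ancestry T \<Longrightarrow> (a, b) \<in> ancestry T \<or> (b, a) \<in> ancestry T"
  by (meson ancestry_iff_prefix ancestry_verts prefix_same_cases)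

lemma root_ancestry: "v \<in> verts T \<Longrightarrow> (rt T, v) \<in> ancestry T"
  using ancestry_iff root_path_props(7) by blast

lemma root_path_root: "root_path T (rt T) = [rt T]"
  using T by (intro root_path_eqI) (auto simp: path_def rooted_tree_def)

lemma gdist_root:
  assumes "v \<in> verts T"
  shows "length (root_path T v) = Suc (gdist T (rt T) v)"
proof -
  let ?n = "length (root_path T v) - 1"
  have n: "length (root_path T v) = Suc ?n" using root_path_props(1)[OF assms] by simp
  have "gdist T (rt T) v = ?n"
    unfolding gdist_def
  proof (rule Least_equality)
    show "\<exists>p. walk T (rt T) p v \<and> length p = Suc ?n"
      using path_root_path[OF assms] n unfolding path_def by blast
  next
    fix m assume "\<exists>p. walk T (rt T) p v \<and> length p = Suc m"
    then obtain p where p: "walk T (rt T) p v" "length p = Suc m" by blast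
    obtain q where "path T (rt T) q v" "length q \<le> length p" using walk_shorten[OF p(1)] .
    then show "?n \<le> m" using root_path_eqI p(2) by fastforce
  qed
  then show ?thesis using n by simp
qed

lemma root_path_edge:
  assumes e: "{x, y} \<in> edges T" and "y \<notin> set (root_path T x)"
  shows "root_path T y = root_path T x @ [y]"
proof (rule root_path_eqI)
  have "walk T (rt T) (root_path T x) x" "distinct (root_path T x)"
    using path_root_path[of x] edge_verts[OF e] by (auto simp: path_def)
  then show "path T (rt T) (root_path T x @ [y]) y"
    using walk_snoc[of T "rt T" "root_path T x" x y] e edge_verts[OF e] assms(2)
    by (auto simp: path_def)
qed

text \<open>By antisymmetry one end of an edge is not on the root path of the other end, which can then be
  extended along the edge.\<close>

lemma edge_oriented:
  assumes e: "e \<in> edges T"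
  obtains p u where "e = {p, u}" "p \<in> verts T" "u \<in> verts T" "p \<noteq> u"
    "root_path T u = root_path T p @ [u]"
proof -
  have "card e = 2" using T e unfolding rooted_tree_def by blast
  then obtain x y where xy: "e = {x, y}" "x \<noteq> y" by (auto simp: card_2_iff)
  have v: "x \<in> verts T" "y \<in> verts T" using edge_verts e xy by auto
  show ?thesis
  proof (cases "y \<in> set (root_path T x)")
    case False
    then show ?thesis using that[of x y] root_path_edge[of x y] e xy v by simp
  next
    case True
    then have "(y, x) \<in> ancestry T" using ancestry_iff v by simp
    then have "(x, y) \<notin> ancestry T" using antisym_ancestry xy(2) by (auto dest: antisymD)
    then have "x \<notin> set (root_path T y)" using ancestry_iff v by simp
    then show ?thesis using that[of y x] root_path_edge[of y x] e xy v by (simp add: insert_commute)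
  qed
qed

lemma far_end_eq:
  assumes "p \<in> verts T" "u \<in> verts T" "root_path T u = root_path T p @ [u]"
  shows "far_end T {p, u} = u"
proof -
  have "gdist T (rt T) p < gdist T (rt T) u"
    using gdist_root[of p] gdist_root[of u] assms by simp
  then show ?thesis unfolding far_end_def by (intro the_equality) auto
qed

text \<open>The normal form of an edge in which it is used below: the end other than \<open>far_end\<close> is the parent
  of \<open>far_end\<close>.\<close>

lemma edge_cases:
  assumes "e \<in> edges T"
  obtains p where "e = {p, far_end T e}" "p \<in> verts T" "far_end T e \<in> verts T" "p \<noteq> far_end T e"
    "root_path T (far_end T e) = root_path T p @ [far_end T e]"
  using edge_oriented[OF assms] far_end_eq by metis

lemma bij_betw_far_end: "bij_betw (far_end T) (edges T) (verts T - {rt T})"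
proof (rule bij_betwI')
  fix e f assume e: "e \<in> edges T" and f: "f \<in> edges T"
  obtain p where p: "e = {p, far_end T e}" "p \<in> verts T"
    "root_path T (far_end T e) = root_path T p @ [far_end T e]"
    using edge_cases[OF e] by metis
  obtain q where q: "f = {q, far_end T f}" "q \<in> verts T"
    "root_path T (far_end T f) = root_path T q @ [far_end T f]"
    using edge_cases[OF f] by metis
  show "far_end T e = far_end T f \<longleftrightarrow> e = f"
    using p q root_path_inj by (metis butlast_snoc)
next
  fix e assume e: "e \<in> edges T"
  obtain p where p: "far_end T e \<in> verts T" "p \<in> verts T"
    "root_path T (far_end T e) = root_path T p @ [far_end T e]"
    using edge_cases[OF e] by metis
  then have "far_end T e \<noteq> rt T" using root_path_root root_path_props(1)[of p] by auto
  then show "far_end T e \<in> verts T - {rt T}" using p by simp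
next
  fix u assume u: "u \<in> verts T - {rt T}"
  let ?p = "root_path T u"
  have "?p \<noteq> [u]" using u root_path_props(2)[of u] by auto
  then have "butlast ?p \<noteq> []"
    using root_path_props(1,3)[of u] u by (metis DiffD1 append_Nil append_butlast_last_id)
  then obtain xs p where xs: "butlast ?p = xs @ [p]" by (metis rev_exhaust)
  then have up: "?p = xs @ p # [u]"
    using root_path_props(1,3)[of u] u
    by (metis DiffD1 append.assoc append_Cons append_Nil append_butlast_last_id)
  have rp: "root_path T p = xs @ [p]" using root_path_append[OF _ up] u by simp
  have "{p, u} \<in> edges T"
    using path_root_path[of u] u by (simp add: up path_def walk_def successively_append_iff)
  moreover have "far_end T {p, u} = u"
    using far_end_eq[of p u] rp up u edge_verts[OF calculation] by simp
  ultimately show "\<exists>e\<in>edges T. u = far_end T e" by metis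
qed

lemma card_verts_eq_Suc_card_edges: "card (verts T) = Suc (card (edges T))"
proof -
  have "finite (verts T)" "rt T \<in> verts T" using T by (auto simp: rooted_tree_def)
  then show ?thesis
    using bij_betw_same_card[OF bij_betw_far_end] by (metis card_Suc_Diff1)
qed

end


section \<open>The two parts of a tree cut at an edge\<close>

lemma rooted_tree_component:
  assumes fin: "finite (verts S)" and x: "x \<in> verts S"
    and edges: "\<And>e. e \<in> edges S \<Longrightarrow> e \<subseteq> verts S \<and> card e = 2"
    and acyclic: "\<nexists>c. cycle S c"
  shows "rooted_tree (component S x)"
proof -
  let ?K = "component S x"
  have V: "verts ?K = {v. \<exists>p. walk S x p v}" and E: "edges ?K = {f \<in> edges S. f \<subseteq> verts ?K}"
    and R: "rt ?K = x"
    by (simp_all add: component_def Let_def)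
  have sub: "verts ?K \<subseteq> verts S"
    unfolding V using walk_end_in_verts by fastforce
  have walkK: "walk ?K x p v" if "walk S x p v" for p v
  proof -
    have verts: "set p \<subseteq> verts ?K"
    proof
      fix y assume "y \<in> set p"
      then obtain p1 p2 where "p = p1 @ y # p2" using split_list by metis
      then have "walk S x (p1 @ [y]) y" using that walk_append_iff by metis
      then show "y \<in> verts ?K" unfolding V by blast
    qed
    have "successively (\<lambda>a b. {a, b} \<in> edges S) p" using that by (simp add: walk_def)
    then have "successively (\<lambda>a b. {a, b} \<in> edges ?K) p"
      by (rule successively_mono) (use verts E in auto)
    then show ?thesis using that verts by (simp add: walk_def)
  qed
  have connected: "\<exists>p. walk ?K u p v" if uv: "u \<in> verts ?K" "v \<in> verts ?K" for u v
  proof -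
    obtain p q where p: "walk S x p u" and q: "walk S x q v" using uv unfolding V by blast
    obtain q' where q': "q = x # q'" using q by (cases q) (auto simp: walk_def)
    obtain p' where p': "rev p = p' @ [x]"
      using p by (metis hd_Cons_tl rev.simps(2) walk_def)
    have "walk ?K u (p' @ [x]) x" using walk_rev[OF walkK[OF p]] by (simp add: p')
    moreover have "walk ?K x (x # q') v" using walkK[OF q] by (simp add: q')
    ultimately have "walk ?K u (p' @ x # q') v" using walk_append_iff by metis
    then show ?thesis by blast
  qed
  have "\<nexists>c. cycle ?K c"
    using acyclic walk_mono[of ?K _ _ _ S] sub E unfolding cycle_def by blast
  moreover have "walk S x [x] x" using x by simp
  then have "x \<in> verts ?K" unfolding V by blast
  ultimately show ?thesis
    using finite_subset[OF sub fin] connected edges E R unfolding rooted_tree_def by auto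
qed

lemma walk_delete_edge_mono: "walk (delete_edge T e) u p v \<Longrightarrow> walk T u p v"
  by (erule walk_mono) (auto simp: delete_edge_def)

lemma walk_delete_edge:
  assumes "walk T u p v" and "\<And>a b. a \<in> set p \<Longrightarrow> b \<in> set p \<Longrightarrow> {a, b} \<noteq> e"
  shows "walk (delete_edge T e) u p v"
proof -
  have "successively (\<lambda>x y. {x, y} \<in> edges T - {e}) p"
    by (rule successively_mono[of "\<lambda>x y. {x, y} \<in> edges T"]) (use assms in \<open>auto simp: walk_def\<close>)
  then show ?thesis using assms(1) by (auto simp: walk_def delete_edge_def)
qed

lemma walk_component_mono: "walk (component S x) u p v \<Longrightarrow> walk S u p v"
proof (erule walk_mono)
  show "verts (component S x) \<subseteq> verts S"
    using walk_end_in_verts by (fastforce simp: component_def Let_def)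
qed (auto simp: component_def Let_def)

lemma path_component_delete_edge_mono:
  assumes "path (component (delete_edge T e) x) u p v"
  shows "path T u p v"
proof -
  have "walk (component (delete_edge T e) x) u p v" using assms by (simp add: path_def)
  then have "walk T u p v" by (rule walk_delete_edge_mono[OF walk_component_mono])
  then show ?thesis using assms by (simp add: path_def)
qed

context
  fixes T :: "'a rgraph" and e :: "'a set"
  assumes T: "rooted_tree T" and e: "e \<in> edges T"
begin

lemma rooted_tree_component_delete_edge:
  assumes "x \<in> verts T"
  shows "rooted_tree (component (delete_edge T e) x)"
proof (rule rooted_tree_component)
  show "\<nexists>c. cycle (delete_edge T e) c"
  proof
    assume "\<exists>c. cycle (delete_edge T e) c"
    then obtain c u where "walk (delete_edge T e) u c u" "length c \<ge> 4" "distinct (tl c)"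
      unfolding cycle_def by blast
    then have "cycle T c" using walk_delete_edge_mono[of T e u c u] unfolding cycle_def by blast
    then show False using T unfolding rooted_tree_def by blast
  qed
qed (use T assms in \<open>auto simp: rooted_tree_def delete_edge_def\<close>)

lemma rooted_tree_root_part: "rooted_tree (root_part T e)"
  unfolding root_part_def using T
  by (intro rooted_tree_component_delete_edge) (simp add: rooted_tree_def)

lemma rooted_tree_far_part: "rooted_tree (far_part T e)"
  unfolding far_part_def using edge_cases[OF T e]
  by (metis rooted_tree_component_delete_edge)

text \<open>The only edge that leaves the set of descendants of \<open>far_end T e\<close> is \<open>e\<close>. Hence once \<open>e\<close> is
  deleted, no walk leaves or enters this set, which identifies both components.\<close>

lemma descendants_closed:
  assumes "{a, b} \<in> edges T - {e}" "(far_end T e, a) \<in> ancestry T"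
  shows "(far_end T e, b) \<in> ancestry T"
proof -
  let ?u = "far_end T e"
  obtain p where p: "e = {p, ?u}" "p \<in> verts T" "?u \<in> verts T"
    "root_path T ?u = root_path T p @ [?u]"
    using edge_cases[OF T e] by metis
  have ab: "{a, b} \<in> edges T" "a \<in> verts T" "b \<in> verts T"
    using assms(1) edge_verts[OF T] by blast+
  show ?thesis
  proof (cases "b \<in> set (root_path T a)")
    case False
    then have "root_path T b = root_path T a @ [b]" using root_path_edge[OF T] ab by blast
    then show ?thesis using assms(2) ab by (simp add: ancestry_iff[OF T])
  next
    case True
    have "a \<noteq> b" using edge_verts[OF T ab(1)] by simp
    have "(b, a) \<in> ancestry T" using True ab by (simp add: ancestry_iff[OF T])
    then have "(a, b) \<notin> ancestry T"
      using antisym_ancestry[OF T] \<open>a \<noteq> b\<close> by (auto dest: antisymD)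
    then have "a \<notin> set (root_path T b)" using ab by (simp add: ancestry_iff[OF T])
    then have ra: "root_path T a = root_path T b @ [a]"
      using root_path_edge[OF T, of b a] ab by (simp add: insert_commute)
    \<comment> \<open>Here \<open>b\<close> is the parent of \<open>a\<close>, so the only danger is that the edge is \<open>e\<close> itself.\<close>
    have "a \<noteq> ?u"
    proof
      assume "a = ?u"
      then have "root_path T b = root_path T p" using ra p by simp
      then have "b = p" using root_path_inj[OF T] ab p by blast
      then show False using assms(1) p(1) \<open>a = ?u\<close> by (auto simp: insert_commute)
    qed
    then show ?thesis using assms(2) ab ra by (simp add: ancestry_iff[OF T])
  qed
qed

lemma verts_root_part:
  "verts (root_part T e) = {x \<in> verts T. (far_end T e, x) \<notin> ancestry T}"
proof (intro set_eqI iffI)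
  fix x assume "x \<in> verts (root_part T e)"
  then obtain p where p: "walk (delete_edge T e) (rt T) p x"
    by (auto simp: root_part_def component_def Let_def)
  have "x \<in> verts T" using p last_in_set[of p] by (auto simp: walk_def delete_edge_def)
  have "far_end T e \<noteq> rt T" using bij_betw_far_end[OF T] e by (auto dest: bij_betwE)
  then have "rt T \<in> {x. (far_end T e, x) \<notin> ancestry T}"
    using ancestry_iff[OF T] root_path_root[OF T] by simp
  moreover have "b \<in> {x. (far_end T e, x) \<notin> ancestry T}"
    if "a \<in> {x. (far_end T e, x) \<notin> ancestry T}" "{a, b} \<in> edges (delete_edge T e)" for a b
    using that descendants_closed[of b a] by (auto simp: delete_edge_def insert_commute)
  ultimately have "x \<in> {x. (far_end T e, x) \<notin> ancestry T}"
    by (rule walk_in_closed_set[OF p])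
  then show "x \<in> {x \<in> verts T. (far_end T e, x) \<notin> ancestry T}" using \<open>x \<in> verts T\<close> by simp
next
  fix x assume x: "x \<in> {x \<in> verts T. (far_end T e, x) \<notin> ancestry T}"
  let ?p = "root_path T x"
  have u: "far_end T e \<notin> set ?p" using x ancestry_iff[OF T] by simp
  have "walk T (rt T) ?p x" using path_root_path[OF T] x by (simp add: path_def)
  moreover have "{a, b} \<noteq> e" if "a \<in> set ?p" "b \<in> set ?p" for a b
    using that u edge_cases[OF T e] by (metis insert_iff doubleton_eq_iff)
  ultimately have "walk (delete_edge T e) (rt T) ?p x"
    by (rule walk_delete_edge)
  then show "x \<in> verts (root_part T e)" by (auto simp: root_part_def component_def Let_def)
qed

lemma verts_far_part:
  "verts (far_part T e) = {x \<in> verts T. (far_end T e, x) \<in> ancestry T}"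
proof (intro set_eqI iffI)
  fix x assume "x \<in> verts (far_part T e)"
  then obtain p where p: "walk (delete_edge T e) (far_end T e) p x"
    by (auto simp: far_part_def component_def Let_def)
  have "x \<in> verts T" using p last_in_set[of p] by (auto simp: walk_def delete_edge_def)
  have "far_end T e \<in> verts T" using edge_cases[OF T e] by metis
  then have "far_end T e \<in> {x. (far_end T e, x) \<in> ancestry T}"
    using refl_on_ancestry[OF T] by (simp add: refl_on_def)
  moreover have "b \<in> {x. (far_end T e, x) \<in> ancestry T}"
    if "a \<in> {x. (far_end T e, x) \<in> ancestry T}" "{a, b} \<in> edges (delete_edge T e)" for a b
    using that descendants_closed[of a b] by (simp add: delete_edge_def)
  ultimately have "x \<in> {x. (far_end T e, x) \<in> ancestry T}"
    by (rule walk_in_closed_set[OF p])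
  then show "x \<in> {x \<in> verts T. (far_end T e, x) \<in> ancestry T}" using \<open>x \<in> verts T\<close> by simp
next
  fix x assume x: "x \<in> {x \<in> verts T. (far_end T e, x) \<in> ancestry T}"
  let ?u = "far_end T e"
  obtain q where q: "e = {q, ?u}" "q \<in> verts T" "?u \<in> verts T" "q \<noteq> ?u"
    "root_path T ?u = root_path T q @ [?u]"
    using edge_cases[OF T e] by metis
  obtain ys where ys: "root_path T x = root_path T q @ ?u # ys"
    using x q ancestry_iff_prefix[OF T] by (auto simp: prefix_def)
  have pth: "path T (rt T) (root_path T q @ ?u # ys) x"
    using path_root_path[OF T, of x] x ys by simp
  have w: "walk T ?u (?u # ys) x" and d: "distinct (root_path T q @ ?u # ys)"
    using path_appendD(2)[OF pth] pth by (auto simp: path_def)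
  have "q \<notin> set (?u # ys)" using d root_path_props(6)[OF T q(2)] by auto
  then have "{a, b} \<noteq> e" if "a \<in> set (?u # ys)" "b \<in> set (?u # ys)" for a b
    using that q(1) by (metis insert_iff doubleton_eq_iff)
  then have "walk (delete_edge T e) ?u (?u # ys) x"
    by (rule walk_delete_edge[OF w])
  then show "x \<in> verts (far_part T e)" by (auto simp: far_part_def component_def Let_def)
qed

lemma root_path_root_part:
  assumes "x \<in> verts (root_part T e)"
  shows "root_path (root_part T e) x = root_path T x"
proof -
  have "path (root_part T e) (rt T) (root_path (root_part T e) x) x"
    using path_root_path[OF rooted_tree_root_part assms]
    by (simp add: root_part_def component_def Let_def)
  then have "path T (rt T) (root_path (root_part T e) x) x"
    unfolding root_part_def by (rule path_component_delete_edge_mono)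
  then show ?thesis using root_path_eqI[OF T] by simp
qed

lemma ancestry_root_part:
  assumes "x \<in> verts (root_part T e)"
  shows "(a, x) \<in> ancestry (root_part T e) \<longleftrightarrow> (a, x) \<in> ancestry T"
  using assms verts_root_part root_path_root_part[OF assms]
  by (simp add: ancestry_iff[OF T] ancestry_iff[OF rooted_tree_root_part])

text \<open>The root path of a vertex of the far part is the root path of the parent of \<open>far_end T e\<close>,
  which lies in the root part, followed by the root path inside the far part.\<close>

lemma ancestry_far_part:
  assumes "a \<in> verts (far_part T e)" "x \<in> verts (far_part T e)"
  shows "(a, x) \<in> ancestry (far_part T e) \<longleftrightarrow> (a, x) \<in> ancestry T"
proof -
  let ?u = "far_end T e" and ?S = "far_part T e"
  obtain q where q: "e = {q, ?u}" "q \<in> verts T" "?u \<in> verts T" "q \<noteq> ?u"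
    "root_path T ?u = root_path T q @ [?u]"
    using edge_cases[OF T e] by metis
  have above: "y \<notin> set (root_path T q)" if "y \<in> verts ?S" for y
  proof
    assume "y \<in> set (root_path T q)"
    then have "(y, q) \<in> ancestry T" using q ancestry_iff[OF T] by simp
    moreover have "(?u, y) \<in> ancestry T" using that verts_far_part by simp
    ultimately have "(?u, q) \<in> ancestry T" using trans_ancestry[OF T] by (meson transD)
    moreover have "(q, ?u) \<in> ancestry T"
      using q ancestry_iff[OF T] root_path_props(6)[OF T q(2)] by simp
    ultimately show False using antisym_ancestry[OF T] q(4) by (auto dest: antisymD)
  qed
  have pS: "path ?S ?u (root_path ?S x) x"
    using path_root_path[OF rooted_tree_far_part assms(2)]
    by (simp add: far_part_def component_def Let_def)
  then have pT: "path T ?u (root_path ?S x) x"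
    unfolding far_part_def by (rule path_component_delete_edge_mono)
  obtain ys where ys: "root_path ?S x = ?u # ys"
    using pS by (cases "root_path ?S x") (auto simp: path_def walk_def)
  have "walk T (rt T) (root_path T q @ [?u]) ?u"
    using path_root_path[OF T q(3)] q(5) by (simp add: path_def)
  then have "walk T (rt T) (root_path T q @ ?u # ys) x"
    using pT ys walk_append_iff[of T "rt T" "root_path T q" ?u ys x] by (simp add: path_def)
  moreover have "distinct (root_path T q @ ?u # ys)"
    using root_path_props(4)[OF T q(2)] pS above ys
    by (auto simp: path_def walk_def)
  ultimately have "path T (rt T) (root_path T q @ root_path ?S x) x"
    by (simp add: ys path_def)
  then have "root_path T x = root_path T q @ root_path ?S x" using root_path_eqI[OF T] by simp
  then show ?thesis
    using above[OF assms(1)] assms verts_far_part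
    by (simp add: ancestry_iff[OF T] ancestry_iff[OF rooted_tree_far_part])
qed

text \<open>With edges named by their far ends, \<open>edge_succ T e f\<close> says that \<open>far_end T e\<close> is not a weak
  ancestor of \<open>far_end T f\<close>. This form makes it evident that the relation does not change when
  it is computed in a root part instead of the full tree.\<close>

lemma edges_root_part_iff:
  "f \<in> edges (root_part T e) \<longleftrightarrow> f \<in> edges T \<and> (far_end T e, far_end T f) \<notin> ancestry T"
proof -
  let ?u = "far_end T e"
  have E: "f \<in> edges (root_part T e) \<longleftrightarrow> f \<in> edges T \<and> f \<noteq> e \<and> f \<subseteq> verts (root_part T e)"
    by (auto simp: root_part_def component_def Let_def delete_edge_def)
  show ?thesis
  proof (cases "f \<in> edges T")
    case True
    obtain q where q: "f = {q, far_end T f}" "q \<in> verts T" "far_end T f \<in> verts T"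
      "root_path T (far_end T f) = root_path T q @ [far_end T f]"
      using edge_cases[OF T True] by metis
    have "(?u, q) \<in> ancestry T \<Longrightarrow> (?u, far_end T f) \<in> ancestry T"
      using q by (simp add: ancestry_iff[OF T])
    moreover have "?u \<in> verts T" using edge_cases[OF T e] by metis
    then have "(?u, ?u) \<in> ancestry T" using refl_on_ancestry[OF T] by (simp add: refl_on_def)
    moreover have "{q, far_end T f} \<subseteq> verts (root_part T e) \<longleftrightarrow>
        (?u, q) \<notin> ancestry T \<and> (?u, far_end T f) \<notin> ancestry T"
      unfolding verts_root_part using q(2,3) by simp
    note this[folded q(1)]
    ultimately show ?thesis unfolding E using True by auto
  qed (simp add: E)
qed

lemma far_end_root_part:
  assumes "f \<in> edges (root_part T e)"
  shows "far_end (root_part T e) f = far_end T f"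
proof -
  let ?S = "root_part T e"
  obtain q where q: "f = {q, far_end ?S f}" "q \<in> verts ?S" "far_end ?S f \<in> verts ?S"
    "root_path ?S (far_end ?S f) = root_path ?S q @ [far_end ?S f]"
    using edge_cases[OF rooted_tree_root_part assms] by metis
  have "far_end T {q, far_end ?S f} = far_end ?S f"
    using q(2-4) root_path_root_part verts_root_part by (intro far_end_eq[OF T]) auto
  then show ?thesis using q(1) by simp
qed

end


section \<open>Chains of edges\<close>

lemma edge_succ_root_part:
  assumes T: "rooted_tree T" and e: "e \<in> edges T"
    and f: "f \<in> edges (root_part T e)" and g: "g \<in> edges (root_part T e)"
  shows "edge_succ (root_part T e) f g \<longleftrightarrow> edge_succ T f g"
proof -
  let ?S = "root_part T e"
  have S: "rooted_tree ?S" using rooted_tree_root_part[OF T e] .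
  have fT: "f \<in> edges T" and gT: "g \<in> edges T" using edges_root_part_iff[OF T e] f g by auto
  have "far_end ?S g \<in> verts ?S" using edge_cases[OF S g] by metis
  then have "(far_end T f, far_end T g) \<in> ancestry ?S \<longleftrightarrow> (far_end T f, far_end T g) \<in> ancestry T"
    using ancestry_root_part[OF T e] far_end_root_part[OF T e] g by simp
  then show ?thesis
    unfolding edge_succ_def edges_root_part_iff[OF S f] edges_root_part_iff[OF T fT]
    using f g gT by (simp add: far_end_root_part[OF T e])
qed

text \<open>The members of a chain after its first edge \<open>e\<close> all lie in \<open>root_part T e\<close>, and there the two
  comparison relations agree. So a chain can be built one edge at a time, exactly as \<open>pieces\<close>
  consumes it.\<close>

lemma edge_chains_Suc:
  assumes T: "rooted_tree T"
  shows "edge_chains T (Suc m) = (\<Union>e\<in>edges T. (#) e ` edge_chains (root_part T e) m)"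
proof (intro set_eqI)
  fix es
  show "es \<in> edge_chains T (Suc m) \<longleftrightarrow> es \<in> (\<Union>e\<in>edges T. (#) e ` edge_chains (root_part T e) m)"
  proof (cases es)
    case Nil
    then show ?thesis by (auto simp: edge_chains_def)
  next
    case (Cons e fs)
    have "e # fs \<in> edge_chains T (Suc m) \<longleftrightarrow> fs \<in> edge_chains (root_part T e) m" if e: "e \<in> edges T"
    proof -
      have "sorted_wrt (edge_succ T) fs \<longleftrightarrow> sorted_wrt (edge_succ (root_part T e)) fs"
        if "set fs \<subseteq> edges (root_part T e)"
        using that edge_succ_root_part[OF T e] by (induction fs) (auto simp: subset_iff)
      moreover have "set fs \<subseteq> edges T" if "set fs \<subseteq> edges (root_part T e)"
        using that edges_root_part[of T e] by blast
      moreover have "set fs \<subseteq> edges (root_part T e) \<longleftrightarrow> (\<forall>f\<in>set fs. edge_succ T e f)"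
        by (auto simp: edge_succ_def)
      ultimately show ?thesis using e by (auto simp: edge_chains_def)
    qed
    moreover have "e \<in> edges T" if "e # fs \<in> edge_chains T (Suc m)"
      using that by (auto simp: edge_chains_def)
    ultimately show ?thesis unfolding Cons by auto
  qed
qed


section \<open>A differential equation for \<open>psi\<close>\<close>

text \<open>The inner sum shared by the definitions of \<open>phi\<close> and \<open>psi\<close>, indexed by the length of the chain,
  which is one less than the number of pieces.\<close>

definition chain_sum :: "'a rgraph \<Rightarrow> nat \<Rightarrow> rat" where
  "chain_sum T m = (\<Sum>es\<in>edge_chains T m. prod_list (map phi (pieces T es)))"

lemma finite_edge_chains:
  assumes "rooted_tree T"
  shows "finite (edge_chains T m)"
  by (rule finite_subset[OF _ finite_lists_length_eq[OF rooted_tree_finite_edges[OF assms], of m]])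
     (auto simp: edge_chains_def)

lemma chain_sum_0: "chain_sum T 0 = phi T"
proof -
  have "edge_chains T 0 = {[]}" by (auto simp: edge_chains_def)
  then show ?thesis by (simp add: chain_sum_def)
qed

lemma chain_sum_Suc:
  assumes T: "rooted_tree T"
  shows "chain_sum T (Suc m) = (\<Sum>e\<in>edges T. phi (far_part T e) * chain_sum (root_part T e) m)"
proof -
  have "chain_sum T (Suc m) =
      (\<Sum>e\<in>edges T. \<Sum>es\<in>(#) e ` edge_chains (root_part T e) m. prod_list (map phi (pieces T es)))"
    unfolding chain_sum_def edge_chains_Suc[OF T]
    using rooted_tree_finite_edges[OF T] finite_edge_chains[OF rooted_tree_root_part[OF T]]
    by (intro sum.UNION_disjoint) auto
  also have "\<dots> = (\<Sum>e\<in>edges T. phi (far_part T e) * chain_sum (root_part T e) m)"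
    by (intro sum.cong refl) (simp add: sum.reindex chain_sum_def sum_distrib_left)
  finally show ?thesis .
qed

lemma chain_sum_eq_0:
  assumes T: "rooted_tree T" and m: "card (verts T) \<le> m"
  shows "chain_sum T m = 0"
proof -
  have "length es < card (verts T)" if es: "set es \<subseteq> edges T" "sorted_wrt (edge_succ T) es" for es
  proof -
    have "\<not> edge_succ T e e" for e
      using edges_root_part[of T e] by (auto simp: edge_succ_def)
    then have "distinct es" using es(2) by (induction es) auto
    then have "length es \<le> card (edges T)"
      using card_mono[OF rooted_tree_finite_edges[OF T] es(1)] by (simp add: distinct_card)
    then show ?thesis by (simp add: card_verts_eq_Suc_card_edges[OF T])
  qed
  then have "edge_chains T m = {}" using m by (fastforce simp: edge_chains_def)
  then show ?thesis by (simp add: chain_sum_def)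
qed

text \<open>Chains with as many members as \<open>T\<close> has vertices do not exist, so the range of summation may be
  extended. This lets the polynomials of all root parts of a tree be summed over one common range.\<close>

lemma psi_eq_sum:
  assumes T: "rooted_tree T" and N: "card (verts T) \<le> N"
  shows "psi T = (\<Sum>m<N. monom (chain_sum T m / fact (Suc m)) (Suc m))"
proof -
  have "psi T = (\<Sum>m<card (verts T). monom (chain_sum T m / fact (Suc m)) (Suc m))"
    unfolding psi_def chain_sum_def
    by (rule sum.reindex_bij_witness[where i = Suc and j = "\<lambda>k. k - 1"]) auto
  also have "\<dots> = (\<Sum>m<N. monom (chain_sum T m / fact (Suc m)) (Suc m))"
    using N by (intro sum.mono_neutral_left) (auto simp: chain_sum_eq_0[OF T])
  finally show ?thesis .
qed

lemma pderiv_sum: "pderiv (sum f A) = (\<Sum>x\<in>A. pderiv (f x))"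
  using higher_pderiv_sum[of 1 f A] by simp

lemma smult_sum_right: "smult c (sum f A) = (\<Sum>x\<in>A. smult c (f x))"
  using sum_distrib_left[of "[:c:]" f A] by simp

text \<open>Differentiation turns \<open>t\<^sup>k / k!\<close> into \<open>t\<^sup>k\<^sup>-\<^sup>1 / (k - 1)!\<close>; splitting off the first edge of each chain
  then leaves the polynomials of the root parts.\<close>

lemma pderiv_psi:
  assumes T: "rooted_tree T"
  shows "pderiv (psi T) =
    [:phi T:] + (\<Sum>e\<in>edges T. smult (phi (far_part T e)) (psi (root_part T e)))"
proof -
  let ?N = "card (edges T)"
  have "pderiv (psi T) = (\<Sum>m<Suc ?N. monom (chain_sum T m / fact m) m)"
    unfolding psi_eq_sum[OF T, of "Suc ?N", unfolded card_verts_eq_Suc_card_edges[OF T], OF order.refl]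
      pderiv_sum
    by (intro sum.cong refl) (simp add: pderiv_monom del: of_nat_Suc)
  also have "\<dots> = [:phi T:] + (\<Sum>m<?N. monom (chain_sum T (Suc m) / fact (Suc m)) (Suc m))"
    unfolding sum.lessThan_Suc_shift by (simp add: chain_sum_0 monom_0)
  also have "(\<Sum>m<?N. monom (chain_sum T (Suc m) / fact (Suc m)) (Suc m)) =
    (\<Sum>m<?N. \<Sum>e\<in>edges T. smult (phi (far_part T e))
       (monom (chain_sum (root_part T e) m / fact (Suc m)) (Suc m)))"
    by (simp add: chain_sum_Suc[OF T] sum_divide_distrib monom_sum smult_monom del: fact_Suc)
  also have "\<dots> = (\<Sum>e\<in>edges T. \<Sum>m<?N. smult (phi (far_part T e))
       (monom (chain_sum (root_part T e) m / fact (Suc m)) (Suc m)))"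
    by (rule sum.swap)
  also have "\<dots> = (\<Sum>e\<in>edges T. smult (phi (far_part T e)) (psi (root_part T e)))"
  proof (rule sum.cong[OF refl])
    fix e assume e: "e \<in> edges T"
    have S: "rooted_tree (root_part T e)" using rooted_tree_root_part[OF T e] .
    have "edges (root_part T e) \<subset> edges T" using edges_root_part[of T e] e by blast
    then have "card (verts (root_part T e)) \<le> ?N"
      using psubset_card_mono[OF rooted_tree_finite_edges[OF T]]
      by (simp add: card_verts_eq_Suc_card_edges[OF S] Suc_le_eq)
    then show "(\<Sum>m<?N. smult (phi (far_part T e))
         (monom (chain_sum (root_part T e) m / fact (Suc m)) (Suc m))) =
      smult (phi (far_part T e)) (psi (root_part T e))"
      by (simp only: psi_eq_sum[OF S] smult_sum_right)
  qed
  finally show ?thesis .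
qed

lemma poly_psi_0: "poly (psi T) 0 = 0"
  by (simp add: psi_def poly_sum poly_monom)

lemma coeff_1_psi:
  assumes "rooted_tree T"
  shows "coeff (psi T) 1 = phi T"
  unfolding coeff_1_eq_poly_pderiv pderiv_psi[OF assms] by (simp add: poly_sum poly_psi_0)

text \<open>The recursion that defines \<open>phi\<close> says precisely this.\<close>

lemma poly_psi_1:
  assumes T: "rooted_tree T"
  shows "poly (psi T) 1 = (if card (verts T) = 1 then 1 else 0)"
proof -
  let ?n = "card (verts T)"
  let ?f = "\<lambda>k. 1 / fact k * chain_sum T (k - 1)"
  have "?n > 0" using card_verts_eq_Suc_card_edges[OF T] by simp
  have "poly (psi T) 1 = (\<Sum>k=1..?n. ?f k)"
    by (simp add: psi_def poly_sum poly_monom chain_sum_def)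
  also have "\<dots> = phi T + (\<Sum>k=2..?n. ?f k)"
    using \<open>?n > 0\<close> by (simp add: sum.atLeast_Suc_atMost chain_sum_0 numeral_2_eq_2)
  also have "\<dots> = (if ?n = 1 then 1 else 0)"
    using T by (subst phi.simps) (simp add: chain_sum_def)
  finally show ?thesis .
qed


section \<open>The same differential equation for the strict order polynomial\<close>

definition order_poly :: "'a rgraph \<Rightarrow> rat poly" where
  "order_poly T = strict_order_poly (verts T) (ancestry T)"

text \<open>In a tree the principal up-sets are the whole tree, for the root, and the far parts of the edges,
  whose complements are the root parts.\<close>

lemma pderiv_order_poly:
  assumes T: "rooted_tree T"
  shows "pderiv (order_poly T) = [:coeff (order_poly T) 1:] +
    (\<Sum>e\<in>edges T. smult (coeff (order_poly (far_part T e)) 1) (order_poly (root_part T e)))"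
proof -
  let ?V = "verts T" and ?r = "ancestry T"
  let ?g = "\<lambda>u. smult (coeff (strict_order_poly {x \<in> ?V. (u, x) \<in> ?r} ?r) 1)
                       (strict_order_poly {x \<in> ?V. (u, x) \<notin> ?r} ?r)"
  have fin: "finite ?V" and rt: "rt T \<in> ?V" using T by (auto simp: rooted_tree_def)
  have "pderiv (order_poly T) = (\<Sum>u\<in>?V. ?g u)"
    unfolding order_poly_def
    by (rule pderiv_strict_order_poly_forest[OF fin refl_on_ancestry[OF T] trans_ancestry[OF T]
          antisym_ancestry[OF T] ancestry_forest[OF T]])
  also have "\<dots> = ?g (rt T) + (\<Sum>u\<in>?V - {rt T}. ?g u)"
    by (rule sum.remove[OF fin rt])
  also have "?g (rt T) = [:coeff (order_poly T) 1:]"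
  proof -
    have "{x \<in> ?V. (rt T, x) \<in> ?r} = ?V" "{x \<in> ?V. (rt T, x) \<notin> ?r} = {}"
      using root_ancestry[OF T] by auto
    then show ?thesis unfolding order_poly_def by (simp only: strict_order_poly_empty) simp
  qed
  also have "(\<Sum>u\<in>?V - {rt T}. ?g u) = (\<Sum>e\<in>edges T. ?g (far_end T e))"
    by (rule sum.reindex_bij_betw[OF bij_betw_far_end[OF T], symmetric])
  also have "\<dots> =
    (\<Sum>e\<in>edges T. smult (coeff (order_poly (far_part T e)) 1) (order_poly (root_part T e)))"
  proof (rule sum.cong[OF refl])
    fix e assume e: "e \<in> edges T"
    have "order_poly (far_part T e) = strict_order_poly {x \<in> ?V. (far_end T e, x) \<in> ?r} ?r"
      unfolding order_poly_def verts_far_part[OF T e, symmetric]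
      by (rule strict_order_poly_cong) (rule ancestry_far_part[OF T e])
    moreover have "order_poly (root_part T e) = strict_order_poly {x \<in> ?V. (far_end T e, x) \<notin> ?r} ?r"
      unfolding order_poly_def verts_root_part[OF T e, symmetric]
      by (rule strict_order_poly_cong) (rule ancestry_root_part[OF T e])
    ultimately show "?g (far_end T e) =
      smult (coeff (order_poly (far_part T e)) 1) (order_poly (root_part T e))" by simp
  qed
  finally show ?thesis .
qed

lemma poly_order_poly_0:
  assumes "rooted_tree T"
  shows "poly (order_poly T) 0 = 0"
  unfolding order_poly_def using assms
  by (intro poly_strict_order_poly_0) (auto simp: rooted_tree_def)

text \<open>A constant map is strictly order-preserving only if no two elements are comparable, and the root is
  comparable to every vertex.\<close>

lemma poly_order_poly_1:
  assumes T: "rooted_tree T"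
  shows "poly (order_poly T) 1 = (if card (verts T) = 1 then 1 else 0)"
proof -
  let ?M = "strict_order_maps (verts T) (ancestry T) 1"
  have fin: "finite (verts T)" and rt: "rt T \<in> verts T" using T by (auto simp: rooted_tree_def)
  have "card ?M = (if card (verts T) = 1 then 1 else 0)"
  proof (cases "card (verts T) = 1")
    case True
    then obtain v where "verts T = {v}" by (auto simp: card_1_singleton_iff)
    then have "?M = {v} \<rightarrow>\<^sub>E {1}" by (auto simp: strict_order_maps_def)
    then show ?thesis using True by (simp add: card_PiE)
  next
    case False
    then have "verts T \<noteq> {rt T}" by auto
    then obtain v where v: "v \<in> verts T" "v \<noteq> rt T" using rt by blast
    have "f \<notin> ?M" for f
    proof
      assume f: "f \<in> ?M"
      then have "f (rt T) < f v"
        using v rt root_ancestry[OF T v(1)] unfolding strict_order_maps_def by fastforce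
      moreover have "f v \<in> {1..1}" "f (rt T) \<in> {1..1}"
        using f v(1) rt unfolding strict_order_maps_def by blast+
      ultimately show False by simp
    qed
    then have "?M = {}" by blast
    then show ?thesis using False by simp
  qed
  then show ?thesis
    using poly_strict_order_poly[OF fin, of "ancestry T" 1] by (simp add: order_poly_def)
qed


section \<open>Equality of the two polynomials\<close>

text \<open>The difference of the two polynomials is affine, and an affine function with two zeros vanishes.\<close>

lemma poly_eqI_pderiv_diff_const:
  fixes p q :: "'a::field_char_0 poly"
  assumes deriv: "pderiv p - pderiv q = [:c:]"
    and "poly p 0 = poly q 0" "poly p 1 = poly q 1"
  shows "p = q"
proof -
  have "pderiv (p - q - [:0, c:]) = 0"
    using deriv by (simp add: pderiv_diff pderiv_pCons)
  then have "degree (p - q - [:0, c:]) = 0" by (simp add: pderiv_eq_0_iff)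
  then obtain d where d: "p - q - [:0, c:] = [:d:]" by (metis degree_eq_zeroE)
  have "poly (p - q - [:0, c:]) 0 = 0" "poly (p - q - [:0, c:]) 1 = - c" using assms by simp_all
  then have "d = 0" "c = 0" unfolding d by simp_all
  then show ?thesis using d by simp
qed

theorem theorem4p5:
  fixes T :: "'a rgraph"
  assumes "rooted_tree T"
  shows "psi T = strict_order_poly (verts T) (ancestry T)"
proof -
  have "psi T = order_poly T"
    using assms
  proof (induction "card (edges T)" arbitrary: T rule: less_induct)
    case less
    note T = less.prems
    have IH: "psi S = order_poly S" if "rooted_tree S" "edges S \<subset> edges T" for S
      using that less.hyps psubset_card_mono[OF rooted_tree_finite_edges[OF T]] by blast
    \<comment> \<open>\<open>phi\<close> of a far part is the linear coefficient of its \<open>psi\<close>, so the induction hypothesis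
      identifies all terms of the two differential equations except the constant ones.\<close>
    have "smult (phi (far_part T e)) (psi (root_part T e)) =
      smult (coeff (order_poly (far_part T e)) 1) (order_poly (root_part T e))"
      if e: "e \<in> edges T" for e
    proof -
      have "edges (root_part T e) \<subset> edges T" "edges (far_part T e) \<subset> edges T"
        using edges_root_part[of T e] edges_far_part[of T e] e by blast+
      then have "psi (root_part T e) = order_poly (root_part T e)"
        "psi (far_part T e) = order_poly (far_part T e)"
        using IH rooted_tree_root_part[OF T e] rooted_tree_far_part[OF T e] by blast+
      then show ?thesis using coeff_1_psi[OF rooted_tree_far_part[OF T e]] by simp
    qed
    then have "pderiv (psi T) - pderiv (order_poly T) = [:phi T - coeff (order_poly T) 1:]"
      unfolding pderiv_psi[OF T] pderiv_order_poly[OF T] by simp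
    then show ?case
      by (rule poly_eqI_pderiv_diff_const)
         (simp_all add: poly_psi_0 poly_order_poly_0 poly_psi_1 poly_order_poly_1 T)
  qed
  then show ?thesis by (simp add: order_poly_def)
qed

end
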